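(* Suppose that $G$ is a graph for which there exists a partition $\{S_1, \ldots, S_m\}$ of $V(G)$ such that for each $i$ the induced subgraph $G[S_i]$ is an odd cycle. Suppose that for each $i \geq 2$ each vertex in $S_i$ has at most $\rho$ neighbors in $\bigcup_{j=1}^{i-1} S_j$ (with $\rho = 0$ in the case that $m=1$). Then $AT(G \square P_k) \leq 3+\rho$ for every positive integer $k$.
   Context: All graphs are finite and simple, and digraphs are simple. $G[T]$ denotes the subgraph of $G$ induced by $T\subseteq V(G)$. $P_k$ is the path on $k$ vertices. The Cartesian product $G \square H$ has vertex set $V(G)\times V(H)$, with $(u,v)$ adjacent to $(u',v')$ iff either $u=u'$ and $vv'\in E(H)$, or $v=v'$ and $uu'\in E(G)$. A circulation contained in a digraph $D$ is a spanning subdigraph $E$ of $D$ such that $d^-_E(v)=d^+_E(v)$ (indegree equals outdegree in $E$) for every $v\in V(D)$; it is even (resp. odd) if it has an even (resp. odd) number of edges (the edgeless circulation is even). The Alon-Tarsi number $AT(G)$ is the smallest $k$ for which there is an orientation $D$ of $G$ with maximum indegree $k-1$ such that the number of even circulations and the number of odd circulations contained in $D$ are different. *)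

theory Defs
  imports "Graph_Theory.Graph_Theory" "HOL-Library.Disjoint_Sets"
begin

text \<open>
  A finite simple graph is a value satisfying \<^locale>\<open>pair_graph\<close>: an undirected edge is
  represented by its two opposite arcs, so \<^term>\<open>(u, v) \<in> parcs G\<close> means adjacency. Directed
  graphs are plain \<^typ>\<open>'a pair_pre_digraph\<close> values; \<^const>\<open>with_proj\<close> is a declared coercion
  and is inserted implicitly.
\<close>

definition cycle_graph :: "nat \<Rightarrow> nat pair_pre_digraph" where
  "cycle_graph n =
     \<lparr>pverts = {0..<n},
      parcs = {(i, j). i < n \<and> j < n \<and> (j = (i + 1) mod n \<or> i = (j + 1) mod n)}\<rparr>"

text \<open>The bound \<open>3 \<le> n\<close> is needed: \<open>cycle_graph 1\<close> has a loop.\<close>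

definition is_odd_cycle :: "('a, 'b) pre_digraph \<Rightarrow> bool" where
  "is_odd_cycle G \<longleftrightarrow> (\<exists>n\<ge>3. odd n \<and> digraph_iso G (cycle_graph n))"

definition path_graph :: "nat \<Rightarrow> nat pair_pre_digraph" where
  "path_graph k =
     \<lparr>pverts = {0..<k}, parcs = {(i, j). i < k \<and> j < k \<and> (j = i + 1 \<or> i = j + 1)}\<rparr>"

definition cartesian_product ::
  "'a pair_pre_digraph \<Rightarrow> 'b pair_pre_digraph \<Rightarrow> ('a \<times> 'b) pair_pre_digraph"
  (infixl \<open>\<box>\<close> 70) where
  "G \<box> H =
     \<lparr>pverts = pverts G \<times> pverts H,
      parcs = {((u, v), (u', v')).
        u \<in> pverts G \<and> v \<in> pverts H \<and> u' \<in> pverts G \<and> v' \<in> pverts H \<and>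
        (u = u' \<and> (v, v') \<in> parcs H \<or> v = v' \<and> (u, u') \<in> parcs G)}\<rparr>"

definition orientation :: "'a pair_pre_digraph \<Rightarrow> 'a pair_pre_digraph \<Rightarrow> bool" where
  "orientation D G \<longleftrightarrow>
     pverts D = pverts G \<and> parcs D \<union> (parcs D)\<inverse> = parcs G \<and> parcs D \<inter> (parcs D)\<inverse> = {}"

definition circulation :: "'a pair_pre_digraph \<Rightarrow> 'a pair_pre_digraph \<Rightarrow> bool" where
  "circulation E D \<longleftrightarrow> spanning E D \<and> (\<forall>v\<in>pverts D. in_degree E v = out_degree E v)"

definition even_circulations :: "'a pair_pre_digraph \<Rightarrow> 'a pair_pre_digraph set" where
  "even_circulations D = {E. circulation E D \<and> even (card (parcs E))}"

definition odd_circulations :: "'a pair_pre_digraph \<Rightarrow> 'a pair_pre_digraph set" where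
  "odd_circulations D = {E. circulation E D \<and> odd (card (parcs E))}"

text \<open>Meaningful only for a nonempty vertex set, since otherwise there is no maximum indegree.\<close>

definition max_in_degree :: "'a pair_pre_digraph \<Rightarrow> nat" where
  "max_in_degree D = Max (in_degree D ` pverts D)"

definition alon_tarsi_number :: "'a pair_pre_digraph \<Rightarrow> nat" where
  "alon_tarsi_number G =
     (LEAST k. \<exists>D. orientation D G \<and> k = max_in_degree D + 1 \<and>
        card (even_circulations D) \<noteq> card (odd_circulations D))"

lemma pair_graph_path_graph: "pair_graph (path_graph k)"
proof
  show "finite (parcs (path_graph k))"
    by (rule finite_subset[of _ "{0..<k} \<times> {0..<k}"]) (auto simp: path_graph_def)
qed (auto simp: path_graph_def symmetric_def sym_def)

lemma pair_graph_cycle_graph: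
  assumes "n \<ge> 3"
  shows "pair_graph (cycle_graph n)"
proof
  show "finite (parcs (cycle_graph n))"
    by (rule finite_subset[of _ "{0..<n} \<times> {0..<n}"]) (auto simp: cycle_graph_def)
  fix e assume "e \<in> parcs (cycle_graph n)"
  then show "fst e \<noteq> snd e"
    using assms by (auto simp: cycle_graph_def mod_Suc split: if_splits)
qed (auto simp: cycle_graph_def symmetric_def sym_def)

lemma pair_graph_cartesian_product:
  assumes "pair_graph G" "pair_graph H"
  shows "pair_graph (G \<box> H)"
proof -
  interpret G: pair_graph G by fact
  interpret H: pair_graph H by fact
  show ?thesis
  proof
    show "finite (parcs (G \<box> H))"
      by (rule finite_subset[of _ "(pverts G \<times> pverts H) \<times> (pverts G \<times> pverts H)"])
        (auto simp: cartesian_product_def)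
    show "symmetric (G \<box> H)"
      using G.arcs_symmetric H.arcs_symmetric
      by (auto simp: cartesian_product_def symmetric_def sym_def)
  qed (auto simp: cartesian_product_def dest: G.no_loops' H.no_loops')
qed

end

theory Submission
  imports Defs
begin

text \<open>
  It suffices to find an orientation with indegrees at most \<open>2 + \<rho>\<close> for which the total number of
  circulations is odd, since then the even and the odd ones cannot be equinumerous.

  Orient the edges between different blocks \<open>S\<^sub>i \<times> V(P\<^sub>k)\<close> from the earlier to the later block. They
  raise indegrees by at most \<open>\<rho>\<close> and lie on no circulation, so the number of circulations is the
  product over the blocks, and each block is a copy of \<open>C\<^sub>n \<box> P\<^sub>k\<close>. There, orient every layer
  cyclically except that one edge of layer 0 is reversed, and orient the path edges from layer to
  layer downwards, except upwards in column 0. A circulation crosses from one layer to the next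
  either not at all or exactly once, down some column \<open>z \<noteq> 0\<close> and up column 0; code the first
  possibility by \<open>z = 0\<close>. A cyclic layer joins the crossing \<open>z\<close> above it to the crossing \<open>z'\<close> below it
  in one way if \<open>z \<noteq> z'\<close> and in two ways (empty or the full cycle) if \<open>z = z'\<close>. Hence modulo 2 the
  vector of the numbers of flows ending in crossing \<open>z\<close> is multiplied by \<open>J - I\<close> in each layer, and
  the vector \<open>e\<^sub>0 + e\<^sub>1\<close>, produced by layer 0, is fixed by this matrix. Its entry at \<open>z = 0\<close> is 1.
\<close>

section \<open>Arc sets with prescribed excess\<close>

definition flux :: "'v \<Rightarrow> 'v \<Rightarrow> 'v \<Rightarrow> int" where
  "flux u v w = of_bool (w = u) - of_bool (w = v)"

definition excess :: "('v \<times> 'v) set \<Rightarrow> 'v \<Rightarrow> int" where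
  "excess F w = (\<Sum>a\<in>F. flux (snd a) (fst a) w)"

definition flows :: "('v \<times> 'v) set \<Rightarrow> ('v \<Rightarrow> int) \<Rightarrow> ('v \<times> 'v) set set" where
  "flows A b = {F. F \<subseteq> A \<and> excess F = b}"

lemma flux_self [simp]: "flux u u = (\<lambda>_. 0)"
  by (auto simp: flux_def)

lemma excess_empty [simp]: "excess {} = (\<lambda>_. 0)"
  by (auto simp: excess_def)

lemma excess_Un:
  "\<lbrakk>finite F; finite F'; F \<inter> F' = {}\<rbrakk> \<Longrightarrow> excess (F \<union> F') w = excess F w + excess F' w"
  by (simp add: excess_def sum.union_disjoint)

lemma finite_flows: "finite A \<Longrightarrow> finite (flows A b)"
  by (rule finite_subset[of _ "Pow A"]) (auto simp: flows_def)

text \<open>Measuring against a fixed ambient set \<open>A\<close> lets the arcs of \<open>A\<close>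
  at \<open>w\<close> be listed once; the excess of every subset is then read off from
  membership.\<close>

lemma excess_at:
  assumes "finite A" "F \<subseteq> A"
  shows "excess F w =
    (\<Sum>a\<in>{a \<in> A. snd a = w}. of_bool (a \<in> F)) - (\<Sum>a\<in>{a \<in> A. fst a = w}. of_bool (a \<in> F))"
proof -
  have "(\<Sum>a\<in>F. of_bool (w = f a)) = (\<Sum>a\<in>{a \<in> A. f a = w}. of_bool (a \<in> F) :: int)"
    for f :: "'a \<times> 'a \<Rightarrow> 'a"
  proof -
    have "(\<Sum>a\<in>F. of_bool (w = f a) :: int) = (\<Sum>a\<in>A. of_bool (f a = w \<and> a \<in> F))"
      using assms by (intro sum.mono_neutral_cong_left) auto
    also have "\<dots> = (\<Sum>a\<in>{a \<in> A. f a = w}. of_bool (a \<in> F))"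
      using assms by (intro sum.mono_neutral_cong_right) auto
    finally show ?thesis .
  qed
  then show ?thesis
    unfolding excess_def flux_def sum_subtractf by simp
qed

lemma excess_eq_card:
  assumes "finite F"
  shows "excess F w = int (card {a \<in> F. snd a = w}) - int (card {a \<in> F. fst a = w})"
  using excess_at[OF assms order_refl, of w] by simp

lemma excess_outside:
  "\<lbrakk>F \<subseteq> U \<times> U; w \<notin> U\<rbrakk> \<Longrightarrow> excess F w = 0"
  unfolding excess_def flux_def by (intro sum.neutral) auto

text \<open>Exchanging the two sums counts each arc by its ends; an arc inside \<open>U\<close>
  cancels, so only the boundary of \<open>U\<close> contributes.\<close>

lemma sum_excess:
  assumes "finite U"
  shows "(\<Sum>w\<in>U. excess F w) = (\<Sum>a\<in>F. of_bool (snd a \<in> U) - of_bool (fst a \<in> U))"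
proof -
  have "(\<Sum>w\<in>U. of_bool (w = x) :: int) = of_bool (x \<in> U)" for x
    using assms by (simp add: of_bool_def)
  then show ?thesis
    unfolding excess_def flux_def by (subst sum.swap) (simp add: sum_subtractf)
qed

text \<open>A flow in the union splits uniquely into its traces on \<open>A\<close> and
  \<open>B\<close>, and is sorted by the excess \<open>g\<close> of the first trace.
  \<open>G\<close> has to contain every excess that can occur; a value without a matching pair adds
  zero. In the layer recursion this sum becomes a matrix product.\<close>

lemma card_flows_Un:
  assumes fin: "finite A" "finite B" "finite G" and disj: "A \<inter> B = {}"
    and G: "\<And>F F'. \<lbrakk>F \<subseteq> A; F' \<subseteq> B; \<And>w. excess F w + excess F' w = b w\<rbrakk> \<Longrightarrow> excess F \<in> G"
  shows "card (flows (A \<union> B) b) = (\<Sum>g\<in>G. card (flows A g) * card (flows B (\<lambda>w. b w - g w)))"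
proof -
  define T where "T = (\<Union>g\<in>G. flows A g \<times> flows B (\<lambda>w. b w - g w))"
  have split: "excess (F \<union> F') w = excess F w + excess F' w" if "F \<subseteq> A" "F' \<subseteq> B" for F F' w
    using that fin disj by (intro excess_Un) (auto intro: finite_subset)
  have "bij_betw (\<lambda>(F, F'). F \<union> F') T (flows (A \<union> B) b)"
  proof (rule bij_betw_byWitness[where f' = "\<lambda>F. (F \<inter> A, F \<inter> B)"])
    show "\<forall>a\<in>T. (\<lambda>F. (F \<inter> A, F \<inter> B)) ((\<lambda>(F, F'). F \<union> F') a) = a"
      using disj by (auto simp: T_def flows_def)
    show "\<forall>F\<in>flows (A \<union> B) b. (\<lambda>(F, F'). F \<union> F') (F \<inter> A, F \<inter> B) = F"
      by (auto simp: flows_def)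
    show "(\<lambda>(F, F'). F \<union> F') ` T \<subseteq> flows (A \<union> B) b"
      by (auto simp: T_def flows_def split fun_eq_iff)
    show "(\<lambda>F. (F \<inter> A, F \<inter> B)) ` flows (A \<union> B) b \<subseteq> T"
    proof (clarsimp simp: T_def)
      fix F assume F: "F \<in> flows (A \<union> B) b"
      then have "F = (F \<inter> A) \<union> (F \<inter> B)" and b: "excess F = b"
        by (auto simp: flows_def)
      then have eq: "excess (F \<inter> A) w + excess (F \<inter> B) w = b w" for w
        using split[of "F \<inter> A" "F \<inter> B" w] by simp
      then have "excess (F \<inter> A) \<in> G"
        by (intro G[of _ "F \<inter> B"]) auto
      moreover have "excess (F \<inter> B) = (\<lambda>w. b w - excess (F \<inter> A) w)"
        using eq by (auto simp: fun_eq_iff algebra_simps)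
      ultimately show "\<exists>g\<in>G. F \<inter> A \<in> flows A g \<and> F \<inter> B \<in> flows B (\<lambda>w. b w - g w)"
        by (intro bexI[of _ "excess (F \<inter> A)"]) (auto simp: flows_def)
    qed
  qed
  then have "card (flows (A \<union> B) b) = card T"
    by (rule bij_betw_same_card[symmetric])
  also have "\<dots> = (\<Sum>g\<in>G. card (flows A g \<times> flows B (\<lambda>w. b w - g w)))"
    unfolding T_def using fin by (intro card_UN_disjoint) (auto simp: finite_flows flows_def)
  finally show ?thesis
    by (simp add: card_cartesian_product)
qed

text \<open>The excess of a circulation sums to zero over \<open>U\<close>, while each of its arcs
  in \<open>X\<close> leaves \<open>U\<close> and contributes -1, so none is used. The rest lives on
  two disjoint vertex sets, where balance must hold separately.\<close>

lemma card_circulations_Un_cut: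
  assumes fin: "finite A" "finite B" "finite X" "finite U" and disj: "U \<inter> W = {}"
    and sub: "A \<subseteq> U \<times> U" "B \<subseteq> W \<times> W" "X \<subseteq> U \<times> W"
  shows "card (flows (A \<union> B \<union> X) (\<lambda>_. 0)) = card (flows A (\<lambda>_. 0)) * card (flows B (\<lambda>_. 0))"
proof -
  have "F \<subseteq> A \<union> B" if "F \<in> flows (A \<union> B \<union> X) (\<lambda>_. 0)" for F
  proof
    from that have F: "F \<subseteq> A \<union> B \<union> X" "excess F = (\<lambda>_. 0)"
      by (auto simp: flows_def)
    have finF: "finite F" using F fin by (auto intro: finite_subset)
    have "0 = (\<Sum>w\<in>U. excess F w)" using F by simp
    also have "\<dots> = (\<Sum>a\<in>F. of_bool (snd a \<in> U) - of_bool (fst a \<in> U))"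
      by (rule sum_excess) fact
    also have "\<dots> = (\<Sum>a\<in>F. - of_bool (a \<in> X))"
    proof (rule sum.cong)
      fix a assume "a \<in> F"
      then consider "a \<in> A" | "a \<in> B" | "a \<in> X" using F by auto
      then show "of_bool (snd a \<in> U) - of_bool (fst a \<in> U) = (- of_bool (a \<in> X) :: int)"
        using sub disj by cases (cases a; auto simp: of_bool_def)+
    qed simp
    also have "\<dots> = - int (card (F \<inter> X))"
      using finF by (simp add: sum_negf)
    finally have "F \<inter> X = {}" using finF by simp
    then show "a \<in> A \<union> B" if "a \<in> F" for a
      using that F by auto
  qed
  then have "flows (A \<union> B \<union> X) (\<lambda>_. 0) = flows (A \<union> B) (\<lambda>_. 0)"
    by (auto simp: flows_def)
  also have "card \<dots> = (\<Sum>g\<in>{\<lambda>_. 0}. card (flows A g) * card (flows B (\<lambda>w. 0 - g w)))"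
  proof (rule card_flows_Un)
    show "A \<inter> B = {}" using sub disj by auto
    fix F F' assume F: "F \<subseteq> A" "F' \<subseteq> B" and 0: "\<And>w. excess F w + excess F' w = 0"
    have "excess F w = 0" for w
    proof (cases "w \<in> U")
      case True
      then have "excess F' w = 0"
        using F sub disj by (intro excess_outside[of _ W]) auto
      then show ?thesis using 0[of w] by simp
    next
      case False
      then show ?thesis using F sub by (intro excess_outside[of _ U]) auto
    qed
    then show "excess F \<in> {\<lambda>_. 0}" by auto
  qed (use fin in auto)
  finally show ?thesis by simp
qed

text \<open>Injectivity on \<open>U\<close> carries the excess at \<open>w\<close> over to
  \<open>f w\<close>. Outside \<open>U\<close>, and outside its image, no arc ends, so those
  vertices impose no condition.\<close>

lemma card_circulations_image:
  assumes "inj_on f U" "A \<subseteq> U \<times> U"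
  shows "card (flows (map_prod f f ` A) (\<lambda>_. 0)) = card (flows A (\<lambda>_. 0))"
proof -
  have injA: "inj_on (map_prod f f) A"
    by (rule inj_on_subset[OF map_prod_inj_on[OF assms(1) assms(1)] assms(2)])
  have *: "excess (map_prod f f ` F) = (\<lambda>_. 0) \<longleftrightarrow> excess F = (\<lambda>_. 0)" if "F \<subseteq> A" for F
  proof -
    have sum: "excess (map_prod f f ` F) w = (\<Sum>a\<in>F. flux (f (snd a)) (f (fst a)) w)" for w
      unfolding excess_def
      using inj_on_subset[OF injA that] by (subst sum.reindex) auto
    have inside: "excess (map_prod f f ` F) (f w) = excess F w" if "w \<in> U" for w
      unfolding sum unfolding excess_def
    proof (rule sum.cong[OF refl])
      fix a assume "a \<in> F"
      then have "fst a \<in> U" "snd a \<in> U" using \<open>F \<subseteq> A\<close> assms(2) by auto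
      then show "flux (f (snd a)) (f (fst a)) (f w) = flux (snd a) (fst a) w"
        using that by (simp add: flux_def inj_on_eq_iff[OF assms(1)])
    qed
    have "excess (map_prod f f ` F) w = 0" if "w \<notin> f ` U" for w
      using that \<open>F \<subseteq> A\<close> assms(2) by (intro excess_outside[of _ "f ` U"]) auto
    moreover have "excess F w = 0" if "w \<notin> U" for w
      using that \<open>F \<subseteq> A\<close> assms(2) by (intro excess_outside[of _ U]) auto
    ultimately show ?thesis
      using inside by (metis (no_types, lifting) imageE)
  qed
  have "bij_betw ((`) (map_prod f f)) (flows A (\<lambda>_. 0)) (flows (map_prod f f ` A) (\<lambda>_. 0))"
  proof (rule bij_betw_imageI)
    show "inj_on ((`) (map_prod f f)) (flows A (\<lambda>_. 0))"
      using inj_on_image_Pow[OF injA] by (rule inj_on_subset) (auto simp: flows_def)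
    show "(`) (map_prod f f) ` flows A (\<lambda>_. 0) = flows (map_prod f f ` A) (\<lambda>_. 0)"
    proof (intro equalityI subsetI)
      fix F assume "F \<in> flows (map_prod f f ` A) (\<lambda>_. 0)"
      then have "F \<subseteq> map_prod f f ` A" and 0: "excess F = (\<lambda>_. 0)" by (auto simp: flows_def)
      then obtain F' where "F' \<subseteq> A" "F = map_prod f f ` F'"
        by (auto simp: subset_image_iff)
      then show "F \<in> (`) (map_prod f f) ` flows A (\<lambda>_. 0)"
        using 0 * by (auto simp: flows_def)
    next
      fix F assume "F \<in> (`) (map_prod f f) ` flows A (\<lambda>_. 0)"
      then show "F \<in> flows (map_prod f f ` A) (\<lambda>_. 0)"
        using * by (auto simp: flows_def)
    qed
  qed
  then show ?thesis by (rule bij_betw_same_card[symmetric])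
qed

section \<open>Cycle times path\<close>

text \<open>Vertices are pairs (column, layer), and a ring arc is indexed by the column of its
  tail.\<close>

definition step :: "nat \<Rightarrow> nat \<Rightarrow> nat \<Rightarrow> (nat \<times> nat) \<times> (nat \<times> nat)" where
  "step n s j = ((j, s), (Suc j mod n, s))"

definition cpred :: "nat \<Rightarrow> nat \<Rightarrow> nat" where
  "cpred n j = (if j = 0 then n - 1 else j - 1)"

definition ring :: "nat \<Rightarrow> nat \<Rightarrow> ((nat \<times> nat) \<times> (nat \<times> nat)) set" where
  "ring n s = step n s ` {..<n}"

text \<open>The cyclic ring of layer 0 with the arc from column 1 to column 2 reversed.\<close>
definition acyclic_ring :: "nat \<Rightarrow> ((nat \<times> nat) \<times> (nat \<times> nat)) set" where
  "acyclic_ring n = insert ((2, 0), (1, 0)) (step n 0 ` ({..<n} - {1}))"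

definition down :: "nat \<Rightarrow> nat \<Rightarrow> (nat \<times> nat) \<times> (nat \<times> nat)" where
  "down s j = ((j, s), (j, Suc s))"

definition up :: "nat \<Rightarrow> (nat \<times> nat) \<times> (nat \<times> nat)" where
  "up s = ((0, Suc s), (0, s))"

definition rungs :: "nat \<Rightarrow> nat \<Rightarrow> ((nat \<times> nat) \<times> (nat \<times> nat)) set" where
  "rungs n s = insert (up s) (down s ` {1..<n})"

text \<open>The second argument is the index of the last layer, so there are \<open>k + 1\<close>
  layers.\<close>

primrec ladder :: "nat \<Rightarrow> nat \<Rightarrow> ((nat \<times> nat) \<times> (nat \<times> nat)) set" where
  "ladder n 0 = acyclic_ring n"
| "ladder n (Suc k) = ladder n k \<union> (ring n (Suc k) \<union> rungs n k)"

lemma finite_ring [simp]: "finite (ring n s)"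
  by (simp add: ring_def)

lemma finite_rungs [simp]: "finite (rungs n s)"
  by (simp add: rungs_def)

lemma finite_acyclic_ring [simp]: "finite (acyclic_ring n)"
  by (simp add: acyclic_ring_def)

lemma finite_ladder [simp]: "finite (ladder n k)"
  by (induction k) auto

lemma step_eq_iff [simp]: "step n s i = step n s j \<longleftrightarrow> i = j"
  by (auto simp: step_def)

lemma down_eq_iff [simp]: "down s i = down s j \<longleftrightarrow> i = j"
  by (auto simp: down_def)

lemma up_neq_down [simp]: "up s \<noteq> down s j" "down s j \<noteq> up s"
  by (auto simp: up_def down_def)

section \<open>Flows in one cyclic layer\<close>

lemma Suc_cpred: "j < n \<Longrightarrow> Suc (cpred n j) mod n = j"
  by (auto simp: cpred_def mod_Suc)

lemma cpred_less: "j < n \<Longrightarrow> cpred n j < n"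
  by (auto simp: cpred_def)

lemma cpred_unique: "\<lbrakk>i < n; Suc i mod n = j\<rbrakk> \<Longrightarrow> i = cpred n j"
  by (auto simp: cpred_def mod_Suc split: if_splits)

lemma step_in_ring [simp]: "step n s j \<in> ring n s \<longleftrightarrow> j < n"
  by (auto simp: ring_def)

lemma excess_ring:
  assumes "F \<subseteq> ring n s" "j < n"
  shows "excess F (j, s) = of_bool (step n s (cpred n j) \<in> F) - of_bool (step n s j \<in> F)"
proof -
  have "{a \<in> ring n s. snd a = (j, s)} = {step n s (cpred n j)}"
    using assms(2) by (auto simp: ring_def step_def Suc_cpred cpred_less intro: cpred_unique)
  moreover have "{a \<in> ring n s. fst a = (j, s)} = {step n s j}"
    using assms(2) by (auto simp: ring_def step_def)
  ultimately show ?thesis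
    using excess_at[OF finite_ring assms(1)] by simp
qed

lemma ring_subset: "ring n s \<subseteq> ({..<n} \<times> {s}) \<times> ({..<n} \<times> {s})"
  by (auto simp: ring_def step_def)

lemma excess_ring_outside:
  assumes "F \<subseteq> ring n s" "\<not> (fst w < n \<and> snd w = s)"
  shows "excess F w = 0"
  using assms ring_subset[of n s]
  by (intro excess_outside[of F "{..<n} \<times> {s}"]) (auto simp: mem_Times_iff)

text \<open>Equal excess at a column means that the difference of the two indicator functions is the
  same on the arc entering it and on the arc leaving it. Hence the difference is constant around the
  ring.\<close>

lemma ring_flows_difference:
  fixes b :: "nat \<times> nat \<Rightarrow> int"
  assumes "F \<in> flows (ring n s) b" "F' \<in> flows (ring n s) b" "j < n"
  shows "of_bool (step n s j \<in> F) - of_bool (step n s j \<in> F') =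
    (of_bool (step n s 0 \<in> F) - of_bool (step n s 0 \<in> F') :: int)"
proof -
  have sub: "F \<subseteq> ring n s" "F' \<subseteq> ring n s" using assms by (auto simp: flows_def)
  show ?thesis using assms(3)
  proof (induction j)
    case (Suc j)
    have "excess F (Suc j, s) = excess F' (Suc j, s)"
      using assms by (simp add: flows_def)
    then have "of_bool (step n s j \<in> F) - of_bool (step n s (Suc j) \<in> F) =
        (of_bool (step n s j \<in> F') - of_bool (step n s (Suc j) \<in> F') :: int)"
      using sub Suc.prems by (simp add: excess_ring cpred_def)
    then show ?case using Suc.IH[OF Suc_lessD[OF Suc.prems]] by linarith
  qed simp
qed

text \<open>The constant difference is 0, 1 or -1; in the last two cases one set contains every arc
  of the ring and the other none.\<close>

lemma ring_flows_cases:
  assumes F: "F \<in> flows (ring n s) b" and F': "F' \<in> flows (ring n s) b"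
  shows "F = F' \<or> F = {} \<and> F' = ring n s \<or> F = ring n s \<and> F' = {}"
proof -
  have sub: "F \<subseteq> ring n s" "F' \<subseteq> ring n s" using assms by (auto simp: flows_def)
  have ext: "A = B" if "A \<subseteq> ring n s" "B \<subseteq> ring n s" "\<And>j. j < n \<Longrightarrow> step n s j \<in> A \<longleftrightarrow> step n s j \<in> B"
    for A B
    using that by (fastforce simp: ring_def)
  note d = ring_flows_difference[OF F F']
  consider "step n s 0 \<in> F \<longleftrightarrow> step n s 0 \<in> F'" | "step n s 0 \<in> F" "step n s 0 \<notin> F'"
    | "step n s 0 \<notin> F" "step n s 0 \<in> F'"
    by blast
  then show ?thesis
  proof cases
    case 1
    then have "F = F'" using d by (intro ext sub) (force simp: of_bool_def split: if_splits)
    then show ?thesis ..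
  next
    case 2
    then have *: "step n s j \<in> F \<and> step n s j \<notin> F'" if "j < n" for j
      using d[OF that] by (auto simp: of_bool_def split: if_splits)
    have "F = ring n s" "F' = {}" by (rule ext; use sub * in auto)+
    then show ?thesis by blast
  next
    case 3
    then have *: "step n s j \<notin> F \<and> step n s j \<in> F'" if "j < n" for j
      using d[OF that] by (auto simp: of_bool_def split: if_splits)
    have "F = {}" "F' = ring n s" by (rule ext; use sub * in auto)+
    then show ?thesis by blast
  qed
qed

lemma excess_full_ring: "excess (ring n s) = (\<lambda>_. 0)"
proof
  fix w :: "nat \<times> nat"
  show "excess (ring n s) w = 0"
  proof (cases "fst w < n \<and> snd w = s")
    case True
    then show ?thesis
      using excess_ring[of "ring n s" n s "fst w"] by (cases w) (auto simp: cpred_less)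
  qed (rule excess_ring_outside; simp)
qed

text \<open>The set is the directed path from column \<open>z\<close> to column \<open>z'\<close>,
  wrapping around when \<open>z' < z\<close>. It witnesses that a flow with this excess
  exists.\<close>

lemma excess_arc:
  assumes "z < n" "z' < n" "z \<noteq> z'"
  shows "excess (step n s ` (if z < z' then {z..<z'} else {..<z'} \<union> {z..<n})) = flux (z', s) (z, s)"
    (is "excess ?P = _")
proof
  have sub: "?P \<subseteq> ring n s" using assms by (auto simp: ring_def)
  fix w :: "nat \<times> nat"
  show "excess ?P w = flux (z', s) (z, s) w"
  proof (cases "fst w < n \<and> snd w = s")
    case True
    obtain j where w: "w = (j, s)" "j < n" using True by (cases w) auto
    have mem: "step n s i \<in> ?P \<longleftrightarrow> (if z < z' then z \<le> i \<and> i < z' else i < z' \<or> z \<le> i \<and> i < n)" for i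
      by auto
    show ?thesis
      unfolding w(1) excess_ring[OF sub w(2)] mem flux_def cpred_def
      using assms w(2) by (cases "j = 0"; cases "z < z'"; cases "j = z"; cases "j = z'"; simp; linarith?)
  next
    case False
    then show ?thesis
      using excess_ring_outside[OF sub False] assms by (auto simp: flux_def)
  qed
qed

lemma odd_card_flows_ring:
  assumes "z < n" "z' < n"
  shows "odd (card (flows (ring n s) (flux (z', s) (z, s)))) \<longleftrightarrow> z \<noteq> z'"
proof (cases "z = z'")
  case True
  have "ring n s \<noteq> {}" using assms by (auto simp: ring_def)
  have "flows (ring n s) (\<lambda>_. 0) = {{}, ring n s}"
  proof
    have "{} \<in> flows (ring n s) (\<lambda>_. 0)" by (simp add: flows_def)
    then show "flows (ring n s) (\<lambda>_. 0) \<subseteq> {{}, ring n s}"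
      using ring_flows_cases by blast
  qed (auto simp: flows_def excess_full_ring)
  then show ?thesis using True \<open>ring n s \<noteq> {}\<close> by simp
next
  case False
  define P where "P = step n s ` (if z < z' then {z..<z'} else {..<z'} \<union> {z..<n})"
  have P: "P \<in> flows (ring n s) (flux (z', s) (z, s))"
    using excess_arc[OF assms False, of s] assms by (auto simp: flows_def P_def ring_def)
  have "flux (z', s) (z, s) (z', s) = 1" using False by (simp add: flux_def)
  \<comment> \<open>The empty set and the full ring have excess zero, so a nonzero excess leaves
    only \<open>F = P\<close> in \<open>ring_flows_cases\<close>.\<close>
  then have nz: "flux (z', s) (z, s) \<noteq> (\<lambda>_. 0)" by auto
  have "F = P" if F: "F \<in> flows (ring n s) (flux (z', s) (z, s))" for F
    using ring_flows_cases[OF F P] F nz by (auto simp: flows_def excess_full_ring)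
  then have "flows (ring n s) (flux (z', s) (z, s)) = {P}" using P by blast
  then show ?thesis using False by simp
qed

section \<open>Flows on the rungs between two layers\<close>

lemma excess_rungs_top:
  assumes "F \<subseteq> rungs n s"
  shows "excess F (j, s) = (if j = 0 then of_bool (up s \<in> F) else - of_bool (down s j \<in> F))"
proof (cases "j < n \<or> j = 0")
  case True
  have "{a \<in> rungs n s. snd a = (j, s)} = (if j = 0 then {up s} else {})"
    using True by (auto simp: rungs_def up_def down_def)
  moreover have "{a \<in> rungs n s. fst a = (j, s)} = (if j = 0 then {} else {down s j})"
    using True by (auto simp: rungs_def up_def down_def)
  ultimately show ?thesis
    using excess_at[OF finite_rungs assms] by simp
next
  case False
  have none: "{a \<in> rungs n s. snd a = (j, s)} = {}" "{a \<in> rungs n s. fst a = (j, s)} = {}"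
    and "down s j \<notin> F"
    using False assms by (auto simp: rungs_def up_def down_def)
  then show ?thesis
    unfolding excess_at[OF finite_rungs assms] none using False by simp
qed

text \<open>A rung joins the two layers within one column, so what it brings to one end it takes
  from the other.\<close>

lemma excess_rungs_bottom:
  assumes "F \<subseteq> rungs n s"
  shows "excess F (j, Suc s) = - excess F (j, s)"
proof -
  have "{a \<in> rungs n s. snd a = (j, Suc s)} = {a \<in> rungs n s. fst a = (j, s)}"
    "{a \<in> rungs n s. snd a = (j, s)} = {a \<in> rungs n s. fst a = (j, Suc s)}"
    by (auto simp: rungs_def up_def down_def)
  then show ?thesis
    using excess_at[OF finite_rungs assms] by simp
qed

lemma rungs_subset: "rungs n s \<subseteq> (UNIV \<times> {s, Suc s}) \<times> (UNIV \<times> {s, Suc s})"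
  by (auto simp: rungs_def up_def down_def)

lemma excess_rungs_outside:
  assumes "F \<subseteq> rungs n s" "snd w \<noteq> s" "snd w \<noteq> Suc s"
  shows "excess F w = 0"
  using assms rungs_subset[of n s]
  by (intro excess_outside[of F "UNIV \<times> {s, Suc s}"]) (auto simp: mem_Times_iff)

text \<open>The unique way for a circulation to use the rungs below layer \<open>s\<close> when it sends its
  unit of flow down column \<open>z\<close>; the value \<open>z = 0\<close> encodes that the rungs are not used.\<close>
definition crossing :: "nat \<Rightarrow> nat \<Rightarrow> ((nat \<times> nat) \<times> (nat \<times> nat)) set" where
  "crossing s z = (if z = 0 then {} else {up s, down s z})"

text \<open>Each of the \<open>n\<close> columns of layer \<open>s\<close> meets exactly one rung,
  so the excess prescribed on that layer decides the use of every rung.\<close>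

lemma flows_rungs:
  assumes "z < n"
  shows "flows (rungs n s) (\<lambda>w. flux (z, Suc s) (0, Suc s) w - flux (z, s) (0, s) w) = {crossing s z}"
    (is "flows _ ?b = _")
proof -
  have sub: "crossing s z \<subseteq> rungs n s"
    using assms by (auto simp: crossing_def rungs_def)
  have "excess (crossing s z) w = ?b w" for w
    using assms by (cases w) (auto simp: crossing_def excess_def flux_def up_def down_def)
  then have "crossing s z \<in> flows (rungs n s) ?b"
    using sub by (auto simp: flows_def)
  moreover have "F = crossing s z" if "F \<in> flows (rungs n s) ?b" for F
  proof -
    from that have F: "F \<subseteq> rungs n s" and ex: "excess F w = ?b w" for w
      by (auto simp: flows_def)
    have U: "up s \<in> F \<longleftrightarrow> z \<noteq> 0"
      using ex[of "(0, s)"] excess_rungs_top[OF F, of 0] by (auto simp: flux_def of_bool_def split: if_splits)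
    have D: "down s j \<in> F \<longleftrightarrow> j = z" if "j \<noteq> 0" for j
      using that ex[of "(j, s)"] excess_rungs_top[OF F, of j]
      by (cases "j = z"; cases "down s j \<in> F"; simp add: flux_def)
    have 1: "a \<in> F \<longleftrightarrow> a \<in> crossing s z" if "a = up s \<or> (\<exists>j. a = down s j \<and> j \<noteq> 0)" for a
      using that
    proof (elim disjE exE conjE)
      assume "a = up s"
      then show ?thesis using U by (simp add: crossing_def)
    next
      fix j assume "a = down s j" "j \<noteq> 0"
      then show ?thesis using D[of j] by (simp add: crossing_def)
    qed
    have 2: "a = up s \<or> (\<exists>j. a = down s j \<and> j \<noteq> 0)" if "a \<in> rungs n s" for a
      using that by (auto simp: rungs_def)
    show ?thesis
    proof (rule set_eqI)
      show "a \<in> F \<longleftrightarrow> a \<in> crossing s z" for a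
        using 1[of a] 2[of a] subsetD[OF F, of a] subsetD[OF sub, of a] by blast
    qed
  qed
  ultimately show ?thesis by blast
qed

lemma ring_Int_rungs: "ring n s' \<inter> rungs n s = {}"
  by (auto simp: ring_def rungs_def step_def up_def down_def)

text \<open>The excess on layer \<open>s\<close> forces the rungs to form
  \<open>crossing s z\<close>. In layer \<open>Suc s\<close> this accounts for a flow from column 0
  to column \<open>z\<close>, and the ring has to supply the remaining flow from \<open>z\<close> to
  \<open>z'\<close>.\<close>

lemma card_flows_ring_rungs:
  assumes "z < n" "z' < n"
  shows "card (flows (ring n (Suc s) \<union> rungs n s)
      (\<lambda>w. flux (z', Suc s) (0, Suc s) w - flux (z, s) (0, s) w)) =
    card (flows (ring n (Suc s)) (flux (z', Suc s) (z, Suc s)))" (is "card (flows _ ?b) = _")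
proof -
  let ?g = "flux (z', Suc s) (z, Suc s)"
  have "card (flows (ring n (Suc s) \<union> rungs n s) ?b) =
    (\<Sum>g\<in>{?g}. card (flows (ring n (Suc s)) g) * card (flows (rungs n s) (\<lambda>w. ?b w - g w)))"
  proof (rule card_flows_Un)
    fix F F' assume F: "F \<subseteq> ring n (Suc s)" and F': "F' \<subseteq> rungs n s"
      and sum: "\<And>w. excess F w + excess F' w = ?b w"
    have "excess F (j, t) = ?g (j, t)" for j t
    proof (cases "t = Suc s")
      case True
      have "excess F (j, s) = 0" using F by (intro excess_ring_outside) auto
      then have "excess F' (j, s) = - flux (z, s) (0, s) (j, s)"
        using sum[of "(j, s)"] by (simp add: flux_def)
      then show ?thesis
        using True sum[of "(j, t)"] excess_rungs_bottom[OF F', of j] by (simp add: flux_def)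
    next
      case False
      then show ?thesis using excess_ring_outside[OF F, of "(j, t)"] by (simp add: flux_def)
    qed
    then show "excess F \<in> {?g}" by auto
  qed (auto simp: ring_Int_rungs)
  moreover have "(\<lambda>w. ?b w - ?g w) = (\<lambda>w. flux (z, Suc s) (0, Suc s) w - flux (z, s) (0, s) w)"
    by (auto simp: flux_def)
  ultimately show ?thesis using flows_rungs[OF assms(1)] by simp
qed

section \<open>The interface between a ladder and the next layer\<close>

lemma ladder_subset: "2 < n \<Longrightarrow> ladder n k \<subseteq> ({..<n} \<times> {..k}) \<times> ({..<n} \<times> {..k})"
proof (induction k)
  case 0
  then show ?case by (auto simp: acyclic_ring_def step_def)
next
  case (Suc k)
  then have "ladder n k \<subseteq> ({..<n} \<times> {..Suc k}) \<times> ({..<n} \<times> {..Suc k})" by fastforce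
  moreover have "ring n (Suc k) \<union> rungs n k \<subseteq> ({..<n} \<times> {..Suc k}) \<times> ({..<n} \<times> {..Suc k})"
    using Suc.prems by (auto simp: ring_def rungs_def step_def up_def down_def)
  ultimately show ?case by simp
qed

text \<open>Only rungs can balance the ladder, so its excess lives on layer \<open>k\<close>: +1 in
  each column used downwards and -1 in column 0 if the upward rung is used. These values sum to zero
  and there is a single upward rung, so at most one downward rung is used.\<close>

lemma ladder_excess_crossing:
  assumes n: "2 < n" and F: "F \<subseteq> ladder n k" and F': "F' \<subseteq> ring n (Suc k) \<union> rungs n k"
    and sum: "\<And>w. excess F w + excess F' w = flux (z', Suc k) (0, Suc k) w"
  shows "\<exists>z<n. excess F = flux (z, k) (0, k)"
proof -
  define R where "R = F' \<inter> rungs n k"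
  have "excess F' w = excess (F' \<inter> ring n (Suc k)) w + excess R w" for w
  proof -
    have "F' = (F' \<inter> ring n (Suc k)) \<union> R" using F' by (auto simp: R_def)
    moreover have "finite F'" using F' by (rule finite_subset) simp
    ultimately show ?thesis
      using ring_Int_rungs[of n "Suc k" k] excess_Un[of "F' \<inter> ring n (Suc k)" R w]
      by (auto simp: R_def)
  qed
  then have eF': "excess F' w = excess R w" if "snd w \<noteq> Suc k" for w
    using that excess_ring_outside[of "F' \<inter> ring n (Suc k)" n "Suc k" w] by simp
  have R: "R \<subseteq> rungs n k" by (simp add: R_def)
  have top: "excess F (j, k) = (if j = 0 then - of_bool (up k \<in> R) else of_bool (down k j \<in> R))" for j
    using sum[of "(j, k)"] eF'[of "(j, k)"] excess_rungs_top[OF R, of j]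
    by (cases "j = 0"; cases "up k \<in> R"; cases "down k j \<in> R"; simp add: flux_def)
  have out: "excess F (j, t) = 0" if "t \<noteq> k \<or> j \<ge> n" for j t
  proof (cases "t < k")
    case True
    then show ?thesis
      using sum[of "(j, t)"] eF'[of "(j, t)"] excess_rungs_outside[OF R, of "(j, t)"] by (simp add: flux_def)
  next
    case False
    then show ?thesis
      using that F ladder_subset[OF n] by (intro excess_outside[of F "{..<n} \<times> {..k}"]) fastforce+
  qed
  \<comment> \<open>Both ends of every arc of \<open>F\<close> lie in this rectangle, so its
    contributions cancel.\<close>
  have "0 = (\<Sum>w\<in>{..<n} \<times> {..k}. excess F w)"
  proof -
    have "(\<Sum>a\<in>F. of_bool (snd a \<in> {..<n} \<times> {..k}) - of_bool (fst a \<in> {..<n} \<times> {..k}) :: int) = 0"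
    proof (intro sum.neutral ballI)
      fix a assume "a \<in> F"
      then have "a \<in> ({..<n} \<times> {..k}) \<times> ({..<n} \<times> {..k})"
        using F ladder_subset[OF n, of k] by blast
      then show "of_bool (snd a \<in> {..<n} \<times> {..k}) - of_bool (fst a \<in> {..<n} \<times> {..k}) = (0 :: int)"
        by (simp add: mem_Times_iff)
    qed
    then show ?thesis by (simp add: sum_excess)
  qed
  also have "\<dots> = (\<Sum>j<n. \<Sum>t\<le>k. excess F (j, t))"
    by (simp add: sum.cartesian_product)
  also have "\<dots> = (\<Sum>j<n. excess F (j, k))"
  proof (rule sum.cong[OF refl])
    fix j
    have "(\<Sum>t\<le>k. excess F (j, t)) = (\<Sum>t\<in>{k}. excess F (j, t))"
      using out by (intro sum.mono_neutral_right) auto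
    then show "(\<Sum>t\<le>k. excess F (j, t)) = excess F (j, k)" by simp
  qed
  also have "{..<n} = insert 0 {1..<n}" using n by auto
  also have "(\<Sum>j\<in>insert 0 {1..<n}. excess F (j, k)) =
      (\<Sum>j\<in>{1..<n}. of_bool (down k j \<in> R)) - of_bool (up k \<in> R)"
    by (simp add: top)
  also have "(\<Sum>j\<in>{1..<n}. of_bool (down k j \<in> R) :: int) = int (card {j \<in> {1..<n}. down k j \<in> R})"
    by (auto intro: arg_cong[where f = card])
  finally have card: "card {j \<in> {1..<n}. down k j \<in> R} = of_bool (up k \<in> R)"
    by (simp add: of_bool_def split: if_splits)
  show ?thesis
  proof (cases "up k \<in> R")
    case True
    then obtain z where z: "{j \<in> {1..<n}. down k j \<in> R} = {z}"
      using card by (auto simp: card_1_singleton_iff)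
    have down: "0 < j \<and> j < n \<and> down k j \<in> R \<longleftrightarrow> j = z" for j
      using eqset_imp_iff[OF z, of j] by (simp add: Suc_le_eq)
    have "0 < z" "z < n" using down[of z] by auto
    have "excess F (j, t) = flux (z, k) (0, k) (j, t)" for j t
    proof (cases "t = k \<and> j < n")
      case in_layer: True
      show ?thesis
      proof (cases "j = 0")
        case True
        then show ?thesis using in_layer \<open>up k \<in> R\<close> \<open>0 < z\<close> top[of j] by (simp add: flux_def)
      next
        case False
        then show ?thesis using in_layer top[of j] down[of j] by (simp add: flux_def)
      qed
    next
      case False
      then show ?thesis using out[of t j] \<open>z < n\<close> by (auto simp: flux_def)
    qed
    then show ?thesis using \<open>z < n\<close> by (auto simp: fun_eq_iff)
  next
    case False
    then have "\<And>j. \<lbrakk>0 < j; j < n\<rbrakk> \<Longrightarrow> down k j \<notin> R"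
      using card by (auto simp: Suc_le_eq)
    then have "excess F (j, t) = 0" for j t
      using False top[of j] out[of t j] by (cases "t = k \<and> j < n") auto
    then show ?thesis using n by (intro exI[of _ 0]) (auto simp: fun_eq_iff)
  qed
qed

text \<open>Distinct columns give distinct interface excesses, so the sum over excesses can be
  reindexed by columns.\<close>

lemma inj_flux: "inj_on (\<lambda>z. flux (z, k) (0 :: nat, k)) A"
proof (rule inj_onI)
  fix x y assume *: "flux (x, k) (0 :: nat, k) = flux (y, k) (0, k)"
  show "x = y"
    using fun_cong[OF *, of "(x, k)"] fun_cong[OF *, of "(y, k)"]
    by (auto simp: flux_def of_bool_def split: if_splits)
qed

section \<open>Flows in layer 0\<close>

lemma excess_acyclic_ring:
  assumes "2 < n" "F \<subseteq> acyclic_ring n" "j < n"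
  shows "excess F (j, 0) =
    (if j = 1 then of_bool (step n 0 0 \<in> F) + of_bool (((2, 0), (1, 0)) \<in> F)
     else if j = 2 then - of_bool (step n 0 2 \<in> F) - of_bool (((2, 0), (1, 0)) \<in> F)
     else of_bool (step n 0 (cpred n j) \<in> F) - of_bool (step n 0 j \<in> F))"
proof -
  have ends_in: "{a \<in> acyclic_ring n. snd a = (j, 0)} =
    (if j = 1 then {step n 0 0, ((2, 0), (1, 0))} else if j = 2 then {} else {step n 0 (cpred n j)})"
    using assms(1,3)
    by (auto simp: acyclic_ring_def step_def Suc_cpred cpred_less mod_Suc cpred_def split: if_splits)
  have ends_out: "{a \<in> acyclic_ring n. fst a = (j, 0)} =
    (if j = 1 then {} else if j = 2 then {step n 0 2, ((2, 0), (1, 0))} else {step n 0 j})"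
    using assms(1,3) by (auto simp: acyclic_ring_def step_def)
  have "step n 0 0 \<noteq> ((2, 0), (1, 0))" "step n 0 2 \<noteq> ((2, 0), (1, 0))"
    using assms(1) by (cases "n = 3"; simp add: step_def)+
  then show ?thesis
    unfolding excess_at[OF finite_acyclic_ring assms(2)] ends_in ends_out by simp
qed

lemma odd_card_flows_acyclic_ring:
  assumes n: "2 < n" and z: "z < n"
  shows "odd (card (flows (acyclic_ring n) (flux (z, 0) (0, 0)))) \<longleftrightarrow> z \<le> 1"
proof -
  have key: "z \<le> 1 \<and> F = (if z = 0 then {} else {step n 0 0})"
    if "F \<in> flows (acyclic_ring n) (flux (z, 0) (0, 0))" for F
  proof -
    from that have F: "F \<subseteq> acyclic_ring n" and ex: "excess F w = flux (z, 0) (0, 0) w" for w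
      by (auto simp: flows_def)
    note eq = excess_acyclic_ring[OF n F, unfolded ex]
    have "z \<noteq> 2" using eq[of 2] n by (auto simp: flux_def of_bool_def split: if_splits)
    then have 2: "step n 0 2 \<notin> F" "((2, 0), (1, 0)) \<notin> F"
      using eq[of 2] n by (auto simp: flux_def of_bool_def split: if_splits)
    have z1: "z \<le> 1"
    proof (rule ccontr)
      assume "\<not> z \<le> 1"
      then have "step n 0 0 \<notin> F" using eq[of 1] n by (auto simp: flux_def of_bool_def split: if_splits)
      then show False
        using \<open>\<not> z \<le> 1\<close> eq[of 0] n by (auto simp: flux_def of_bool_def split: if_splits)
    qed
    have tail: "step n 0 j \<notin> F" if "2 \<le> j" "j < n" for j
      using that
    proof (induction j rule: dec_induct)
      case (step j)
      then show ?case
        using eq[of "Suc j"] z1 by (auto simp: flux_def of_bool_def cpred_def split: if_splits)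
    qed (rule 2)
    have "step n 0 0 \<in> F \<longleftrightarrow> z = 1"
      using eq[of 1] n 2 z1 by (auto simp: flux_def of_bool_def split: if_splits)
    moreover have "F \<subseteq> insert (step n 0 0) (insert ((2, 0), (1, 0)) (step n 0 ` {2..<n}))"
    proof -
      have "acyclic_ring n \<subseteq> insert (step n 0 0) (insert ((2, 0), (1, 0)) (step n 0 ` {2..<n}))"
        by (auto simp: acyclic_ring_def)
      then show ?thesis using F by blast
    qed
    ultimately show ?thesis using z1 2 tail by auto
  qed
  show ?thesis
  proof (cases "z \<le> 1")
    case True
    have "(if z = 0 then {} else {step n 0 0}) \<in> flows (acyclic_ring n) (flux (z, 0) (0, 0))"
      using n True by (auto simp: flows_def excess_def acyclic_ring_def step_def le_Suc_eq)
    then have "flows (acyclic_ring n) (flux (z, 0) (0, 0)) = {if z = 0 then {} else {step n 0 0}}"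
      using key by blast
    then show ?thesis using True by simp
  next
    case False
    then have "flows (acyclic_ring n) (flux (z, 0) (0, 0)) = {}" using key by blast
    then show ?thesis using False by simp
  qed
qed

lemma odd_card_flows_ladder:
  assumes n: "2 < n" and "z < n"
  shows "odd (card (flows (ladder n k) (flux (z, k) (0, k)))) \<longleftrightarrow> z \<le> 1"
  using assms(2)
proof (induction k arbitrary: z)
  case 0
  then show ?case using odd_card_flows_acyclic_ring[OF n] by simp
next
  case (Suc k z')
  let ?N = "\<lambda>z. card (flows (ladder n k) (flux (z, k) (0, k)))"
  let ?M = "\<lambda>z. card (flows (ring n (Suc k)) (flux (z', Suc k) (z, Suc k)))"
  have "card (flows (ladder n (Suc k)) (flux (z', Suc k) (0, Suc k))) =
    (\<Sum>g\<in>(\<lambda>z. flux (z, k) (0, k)) ` {..<n}. card (flows (ladder n k) g) *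
      card (flows (ring n (Suc k) \<union> rungs n k) (\<lambda>w. flux (z', Suc k) (0, Suc k) w - g w)))"
    unfolding ladder.simps
  proof (rule card_flows_Un)
    show "ladder n k \<inter> (ring n (Suc k) \<union> rungs n k) = {}"
      using ladder_subset[OF n, of k] by (fastforce simp: ring_def rungs_def step_def up_def down_def)
    show "excess F \<in> (\<lambda>z. flux (z, k) (0, k)) ` {..<n}"
      if "F \<subseteq> ladder n k" "F' \<subseteq> ring n (Suc k) \<union> rungs n k"
        "\<And>w. excess F w + excess F' w = flux (z', Suc k) (0, Suc k) w" for F F'
      using ladder_excess_crossing[OF n that] by auto
  qed auto
  also have "\<dots> = (\<Sum>z<n. ?N z * ?M z)"
    using Suc.prems
    by (subst sum.reindex[OF inj_flux]) (auto intro!: sum.cong simp: card_flows_ring_rungs)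
  finally have "odd (card (flows (ladder n (Suc k)) (flux (z', Suc k) (0, Suc k)))) \<longleftrightarrow>
      odd (card {z \<in> {..<n}. odd (?N z * ?M z)})"
    by (simp add: even_sum_iff)
  \<comment> \<open>By the induction hypothesis only \<open>z = 0\<close> and \<open>z = 1\<close>
    can contribute, and the ring discards \<open>z = z'\<close>. One index survives if
    \<open>z'\<close> is 0 or 1, two otherwise, so the parity pattern reproduces itself.\<close>
  also have "{z \<in> {..<n}. odd (?N z * ?M z)} = {0, 1} - {z'}"
  proof -
    have "odd (?N z * ?M z) \<longleftrightarrow> z \<le> 1 \<and> z \<noteq> z'" if "z < n" for z
      using Suc.IH[OF that] odd_card_flows_ring[OF that Suc.prems, of "Suc k"] by simp
    moreover have "Suc 0 < n" using n by simp
    ultimately show ?thesis by (auto simp: le_Suc_eq)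
  qed
  also have "odd (card ({0, 1} - {z'})) \<longleftrightarrow> z' \<le> 1"
    by (auto simp: card_Diff_singleton_if)
  finally show ?case .
qed

lemma odd_card_circulations_ladder: "2 < n \<Longrightarrow> odd (card (flows (ladder n k) (\<lambda>_. 0)))"
  using odd_card_flows_ladder[of n 0 k] by simp

section \<open>The ladder as an orientation of a cycle times a path\<close>

lemma ladder_iff:
  assumes "2 < n"
  shows "((i, s), (j, t)) \<in> ladder n k \<longleftrightarrow> i < n \<and> j < n \<and> s \<le> k \<and> t \<le> k \<and>
    (s = t \<and> (if s = 0 then j = Suc i mod n \<and> i \<noteq> 1 \<or> i = 2 \<and> j = 1 else j = Suc i mod n)
      \<or> i = j \<and> (if i = 0 then s = Suc t else t = Suc s))"
proof (induction k)
  case 0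
  show ?case using assms by (auto simp: acyclic_ring_def step_def)
next
  case (Suc k)
  show ?case
    unfolding ladder.simps Un_iff Suc.IH using assms
    by (auto simp: ring_def rungs_def step_def up_def down_def image_iff le_Suc_eq)
qed

lemma ladder_adjacent_iff:
  assumes "2 < n"
  shows "((i, s), (j, t)) \<in> ladder n k \<or> ((j, t), (i, s)) \<in> ladder n k \<longleftrightarrow>
    i < n \<and> j < n \<and> s \<le> k \<and> t \<le> k \<and>
    (s = t \<and> (i, j) \<in> parcs (cycle_graph n) \<or> i = j \<and> (t = Suc s \<or> s = Suc t))"
  unfolding ladder_iff[OF assms]
  using assms by (auto simp: cycle_graph_def numeral_2_eq_2 numeral_3_eq_3 mod_Suc split: if_splits)

text \<open>The successor modulo \<open>n\<close> is resolved into the wrap-around and the ordinary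
  case, which leaves only linear arithmetic.\<close>

lemma ladder_cases:
  assumes "2 < n" "((i, s), (j, t)) \<in> ladder n k"
  shows "s = t \<and> (s = 0 \<and> i = 2 \<and> j = 1 \<or>
      (Suc i = n \<and> j = 0 \<or> Suc i < n \<and> j = Suc i) \<and> (s = 0 \<longrightarrow> i \<noteq> 1)) \<or>
    i = j \<and> (i = 0 \<and> s = Suc t \<or> 0 < i \<and> t = Suc s)"
  using assms(2) unfolding ladder_iff[OF assms(1)]
  by (cases "Suc i = n") (auto split: if_splits)

lemma ladder_asym:
  assumes "2 < n" "((i, s), (j, t)) \<in> ladder n k"
  shows "((j, t), (i, s)) \<notin> ladder n k"
proof
  assume "((j, t), (i, s)) \<in> ladder n k"
  from ladder_cases[OF assms] ladder_cases[OF assms(1) this] assms(1) show False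
    by (elim disjE conjE) (linarith | simp)+
qed

text \<open>Ordinarily at most one arc arrives from the ring and at most one from a rung. The
  reversal gives column 1 of layer 0 a second ring arc, but the rung there points away. A reversed
  arc pointing to column 0 would instead meet the incoming upward rung.\<close>

lemma in_degree_ladder:
  assumes "2 < n"
  shows "card {a \<in> ladder n k. snd a = (j, t)} \<le> 2"
proof -
  \<comment> \<open>\<open>P\<close> only has to contain all predecessors. In layer 0 the truncated
    \<open>t - 1\<close> names the vertex itself, and \<open>Suc t\<close> may lie beyond the last
    layer.\<close>
  define P where "P = (if t = 0 \<and> j = 1 then {(0, 0), (2, 0)}
    else {(cpred n j, t), (j, if j = 0 then Suc t else t - 1)})"
  have "{a \<in> ladder n k. snd a = (j, t)} \<subseteq> (\<lambda>p. (p, (j, t))) ` P"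
  proof clarsimp
    fix i s assume "((i, s), (j, t)) \<in> ladder n k"
    from ladder_cases[OF assms this] show "((i, s), (j, t)) \<in> (\<lambda>p. (p, (j, t))) ` P"
      by (auto simp: P_def cpred_def)
  qed
  moreover have "finite P" "card P \<le> 2"
    by (auto simp: P_def card_insert_if)
  ultimately show ?thesis
    by (meson card_image_le card_mono finite_imageI order_trans)
qed

section \<open>Orientations and the Alon-Tarsi number\<close>

text \<open>A spanning subdigraph is determined by its arcs, and a vertex is balanced exactly when
  its excess vanishes.\<close>

lemma bij_betw_parcs_circulations:
  assumes "pair_fin_digraph D"
  shows "bij_betw parcs {E. circulation E D} (flows (parcs D) (\<lambda>_. 0))"
proof (rule bij_betw_byWitness[where f' = "\<lambda>F. \<lparr>pverts = pverts D, parcs = F\<rparr>"])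
  interpret D: pair_fin_digraph D by fact
  have wf: "wf_digraph (with_proj D)" by (simp add: wf_digraph_wp_iff D.pair_wf_digraph_axioms)
  have balanced: "in_degree (with_proj E) v = out_degree (with_proj E) v \<longleftrightarrow> excess (parcs E) v = 0"
    if "parcs E \<subseteq> parcs D" for E v
    using finite_subset[OF that D.pair_finite_arcs]
    by (simp add: excess_eq_card in_degree_def out_degree_def in_arcs_def out_arcs_def)
  have sub: "parcs D \<subseteq> pverts D \<times> pverts D"
    using D.wellformed' by auto
  show "\<forall>E\<in>{E. circulation E D}. \<lparr>pverts = pverts D, parcs = parcs E\<rparr> = E"
    by (auto simp: circulation_def spanning_def)
  show "\<forall>F\<in>flows (parcs D) (\<lambda>_. 0). parcs \<lparr>pverts = pverts D, parcs = F\<rparr> = F"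
    by simp
  show "parcs ` {E. circulation E D} \<subseteq> flows (parcs D) (\<lambda>_. 0)"
  proof clarsimp
    fix E assume E: "circulation E D"
    then have "parcs E \<subseteq> parcs D" by (auto simp: circulation_def spanning_def subgraph_def)
    moreover have "excess (parcs E) v = 0" for v
    proof (cases "v \<in> pverts D")
      case True
      then show ?thesis using E balanced[OF \<open>parcs E \<subseteq> parcs D\<close>] by (simp add: circulation_def)
    next
      case False
      \<comment> \<open>Excess zero is demanded at every element of the type; outside
        \<open>pverts D\<close> it holds because no arc ends there.\<close>
      then show ?thesis using calculation sub by (intro excess_outside) auto
    qed
    ultimately show "parcs E \<in> flows (parcs D) (\<lambda>_. 0)" by (auto simp: flows_def)
  qed
  show "(\<lambda>F. \<lparr>pverts = pverts D, parcs = F\<rparr>) ` flows (parcs D) (\<lambda>_. 0) \<subseteq> {E. circulation E D}"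
  proof clarsimp
    fix F assume F: "F \<in> flows (parcs D) (\<lambda>_. 0)"
    let ?E = "\<lparr>pverts = pverts D, parcs = F\<rparr>"
    have "F \<subseteq> parcs D" using F by (simp add: flows_def)
    then have "wf_digraph (with_proj ?E)"
      using sub by unfold_locales auto
    then have "spanning (with_proj ?E) (with_proj D)"
      using \<open>F \<subseteq> parcs D\<close> wf by (simp add: spanning_def subgraph_def compatible_def)
    then show "circulation ?E D"
      using F balanced[of ?E] by (simp add: circulation_def flows_def)
  qed
qed

text \<open>The even and the odd circulations partition a set of odd size, so their numbers differ
  and \<open>D\<close> competes in the minimum. Nonemptiness makes \<open>max_in_degree\<close> a
  genuine maximum.\<close>

lemma alon_tarsi_number_le:
  assumes D: "orientation D H" "pair_fin_digraph D" "pverts D \<noteq> {}"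
    and deg: "\<And>v. v \<in> pverts D \<Longrightarrow> in_degree (with_proj D) v \<le> d"
    and odd: "odd (card (flows (parcs D) (\<lambda>_. 0)))"
  shows "alon_tarsi_number H \<le> Suc d"
proof -
  interpret D: pair_fin_digraph D by fact
  have bij: "bij_betw parcs {E. circulation E D} (flows (parcs D) (\<lambda>_. 0))"
    by (rule bij_betw_parcs_circulations) fact
  have fin: "finite {E. circulation E D}"
    using bij finite_flows[OF D.pair_finite_arcs] by (simp add: bij_betw_finite)
  have "{E. circulation E D} = even_circulations D \<union> odd_circulations D"
    "even_circulations D \<inter> odd_circulations D = {}"
    by (auto simp: even_circulations_def odd_circulations_def)
  then have "card (even_circulations D) + card (odd_circulations D) = card {E. circulation E D}"
    using fin by (metis card_Un_disjoint finite_Un)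
  also have "\<dots> = card (flows (parcs D) (\<lambda>_. 0))"
    using bij by (rule bij_betw_same_card)
  finally have "card (even_circulations D) \<noteq> card (odd_circulations D)"
    using odd by presburger
  then have "alon_tarsi_number H \<le> max_in_degree D + 1"
    unfolding alon_tarsi_number_def using D(1) by (intro Least_le) blast
  also have "max_in_degree D \<le> d"
    unfolding max_in_degree_def using D.pair_finite_verts D(3) deg by simp
  finally show ?thesis by simp
qed

text \<open>A \<open>digraph_iso\<close> carries a separate map on arcs. Since tail and head are
  \<open>fst\<close> and \<open>snd\<close> on both sides, that map is induced by the vertex map, so
  adjacency transfers along the latter.\<close>

lemma odd_cycle_labelling:
  assumes "pair_graph G" "T \<subseteq> pverts G" "is_odd_cycle (G \<restriction> T)"
  obtains n f where "2 < n" "bij_betw f T {..<n}"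
    "\<And>u v. \<lbrakk>u \<in> T; v \<in> T\<rbrakk> \<Longrightarrow> (u, v) \<in> parcs G \<longleftrightarrow> (f u, f v) \<in> parcs (cycle_graph n)"
proof -
  interpret G: pair_graph G by fact
  obtain n h where n: "3 \<le> n" and h: "pre_digraph.digraph_isomorphism (G \<restriction> T) h"
    and eq: "with_proj (cycle_graph n) = app_iso h (G \<restriction> T)"
    using assms(3) by (auto simp: is_odd_cycle_def digraph_iso_def)
  have inj: "inj_on (iso_verts h) T"
    and ends: "\<And>a. \<lbrakk>a \<in> parcs G; fst a \<in> T; snd a \<in> T\<rbrakk> \<Longrightarrow>
      iso_verts h (fst a) = iso_tail h (iso_arcs h a) \<and> iso_verts h (snd a) = iso_head h (iso_arcs h a)"
    using h by (auto simp: pre_digraph.digraph_isomorphism_def)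
  have verts: "iso_verts h ` T = {..<n}"
    using arg_cong[OF eq, of verts] by (auto simp: cycle_graph_def)
  have arcs: "parcs (cycle_graph n) = iso_arcs h ` {a \<in> parcs G. fst a \<in> T \<and> snd a \<in> T}"
    using arg_cong[OF eq, of arcs] by simp
  have tail: "iso_tail h = fst" and head: "iso_head h = snd"
    using arg_cong[OF eq, of tail] arg_cong[OF eq, of head] by simp_all
  have map: "iso_arcs h a = map_prod (iso_verts h) (iso_verts h) a"
    if "a \<in> parcs G" "fst a \<in> T" "snd a \<in> T" for a
    using ends[OF that] by (cases a) (auto simp: tail head prod_eq_iff)
  have "(u, v) \<in> parcs G \<longleftrightarrow> (iso_verts h u, iso_verts h v) \<in> parcs (cycle_graph n)"
    if "u \<in> T" "v \<in> T" for u v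
  proof
    assume "(u, v) \<in> parcs G"
    then show "(iso_verts h u, iso_verts h v) \<in> parcs (cycle_graph n)"
      using that map[of "(u, v)"] by (force simp: arcs)
  next
    assume "(iso_verts h u, iso_verts h v) \<in> parcs (cycle_graph n)"
    then obtain a where a: "a \<in> parcs G" "fst a \<in> T" "snd a \<in> T"
      "(iso_verts h u, iso_verts h v) = map_prod (iso_verts h) (iso_verts h) a"
      using map by (auto simp: arcs)
    then have "a = (u, v)"
      using that inj by (cases a) (auto dest: inj_onD)
    then show "(u, v) \<in> parcs G" using a by simp
  qed
  then show thesis
    using n inj verts by (intro that[of n "iso_verts h"]) (auto simp: bij_betw_def)
qed

section \<open>Gluing the blocks together\<close>

theorem theorem8:
  fixes G :: "'a pair_pre_digraph"
    and S :: "nat \<Rightarrow> 'a set"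
    and m \<rho> k :: nat
  assumes "pair_graph G"
    and "m \<ge> 1"
    and "partition_on (pverts G) (S ` {1..m})" and "inj_on S {1..m}"
    and "\<And>i. i \<in> {1..m} \<Longrightarrow> is_odd_cycle (G \<restriction> S i)"
    and "\<And>i v. i \<in> {2..m} \<Longrightarrow> v \<in> S i \<Longrightarrow>
           card {w \<in> (\<Union>j\<in>{1..i - 1}. S j). v \<rightarrow>\<^bsub>G\<^esub> w} \<le> \<rho>"
    and "m = 1 \<Longrightarrow> \<rho> = 0"
    and "k \<ge> 1"
  shows "alon_tarsi_number (G \<box> path_graph k) \<le> 3 + \<rho>"
proof -
  interpret G: pair_graph G by fact
  \<comment> \<open>\<open>K\<close> is the index of the last of the \<open>k\<close>
    layers.\<close>
  obtain K where k: "k = Suc K" using \<open>k \<ge> 1\<close> by (cases k) auto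
  have V: "pverts G = (\<Union>i\<in>{1..m}. S i)"
    using assms(3) by (auto simp: partition_on_def)
  have unique: "i = j" if "v \<in> S i" "v \<in> S j" "i \<in> {1..m}" "j \<in> {1..m}" for v i j
  proof (rule ccontr)
    assume "i \<noteq> j"
    then have "S i \<inter> S j = {}"
      using that assms(3,4) by (intro disjointD[of "S ` {1..m}"]) (auto simp: partition_on_def inj_on_eq_iff)
    then show False using that by blast
  qed
  have "\<forall>i\<in>{1..m}. \<exists>n f. 2 < n \<and> bij_betw f (S i) {..<n} \<and>
    (\<forall>u\<in>S i. \<forall>v\<in>S i. (u, v) \<in> parcs G \<longleftrightarrow> (f u, f v) \<in> parcs (cycle_graph n))"
  proof
    fix i assume i: "i \<in> {1..m}"
    show "\<exists>n f. 2 < n \<and> bij_betw f (S i) {..<n} \<and>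
      (\<forall>u\<in>S i. \<forall>v\<in>S i. (u, v) \<in> parcs G \<longleftrightarrow> (f u, f v) \<in> parcs (cycle_graph n))"
      by (rule odd_cycle_labelling[OF assms(1) _ assms(5)[OF i]]) (use i V in auto)
  qed
  then obtain n f where n: "\<And>i. i \<in> {1..m} \<Longrightarrow> 2 < n i"
    and bij: "\<And>i. i \<in> {1..m} \<Longrightarrow> bij_betw (f i) (S i) {..<n i}"
    and adj: "\<And>i u v. \<lbrakk>i \<in> {1..m}; u \<in> S i; v \<in> S i\<rbrakk> \<Longrightarrow>
      (u, v) \<in> parcs G \<longleftrightarrow> (f i u, f i v) \<in> parcs (cycle_graph (n i))"
    by metis
  have "\<forall>v\<in>pverts G. \<exists>i\<in>{1..m}. v \<in> S i" using V by auto
  \<comment> \<open>The partition is turned into a block index, whose order directs the arcs between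
    blocks.\<close>
  then obtain b where b: "\<And>v. v \<in> pverts G \<Longrightarrow> b v \<in> {1..m} \<and> v \<in> S (b v)" by metis
  have b_eq: "b v = i" if "i \<in> {1..m}" "v \<in> S i" for i v
  proof -
    have "v \<in> pverts G" using that V by blast
    then show ?thesis using that b unique by blast
  qed
  have S_V: "v \<in> pverts G" if "i \<in> {1..m}" "v \<in> S i" for i v using that V by auto

  \<comment> \<open>Between blocks, arcs stay in their layer and run to the larger index. Inside a
    block, which includes all path edges, \<open>R\<close> is the ladder pulled back along the
    labelling.\<close>
  define R where "R = {((u, s), (v, t)). u \<in> pverts G \<and> v \<in> pverts G \<and> s \<le> K \<and> t \<le> K \<and>
    (b u < b v \<and> s = t \<and> (u, v) \<in> parcs G \<or>
     b u = b v \<and> ((f (b u) u, s), (f (b u) v, t)) \<in> ladder (n (b u)) K)}"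
  define D where "D = \<lparr>pverts = pverts G \<times> {0..<k}, parcs = R\<rparr>"
  have R_sub: "R \<subseteq> (pverts G \<times> {..K}) \<times> (pverts G \<times> {..K})" by (auto simp: R_def)
  then have fin_R: "finite R" by (rule finite_subset) (simp add: G.pair_finite_verts)
  have D: "pair_fin_digraph D"
    using R_sub fin_R by unfold_locales (auto simp: D_def k G.pair_finite_verts less_Suc_eq_le)

  have same: "((u, s), (v, t)) \<in> R \<or> ((v, t), (u, s)) \<in> R \<longleftrightarrow>
      s \<le> K \<and> t \<le> K \<and> (s = t \<and> (u, v) \<in> parcs G \<or> u = v \<and> (t = Suc s \<or> s = Suc t))"
    if "u \<in> pverts G" "v \<in> pverts G" "b u = b v" for u v s t
  proof -
    let ?i = "b u"
    have i: "?i \<in> {1..m}" "u \<in> S ?i" "v \<in> S ?i" using b[OF that(1)] b[OF that(2)] that(3) by auto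
    then have lt: "f ?i u < n ?i" "f ?i v < n ?i" and eq: "f ?i u = f ?i v \<longleftrightarrow> u = v"
      using bij[OF i(1)] by (auto simp: bij_betw_def inj_on_eq_iff)
    have "((u, s), (v, t)) \<in> R \<or> ((v, t), (u, s)) \<in> R \<longleftrightarrow> s \<le> K \<and> t \<le> K \<and>
        (((f ?i u, s), (f ?i v, t)) \<in> ladder (n ?i) K \<or> ((f ?i v, t), (f ?i u, s)) \<in> ladder (n ?i) K)"
      using that by (auto simp: R_def)
    then show ?thesis
      unfolding ladder_adjacent_iff[OF n[OF i(1)]] using adj[OF i] lt eq by auto
  qed
  have different: "((u, s), (v, t)) \<in> R \<or> ((v, t), (u, s)) \<in> R \<longleftrightarrow>
      s \<le> K \<and> t \<le> K \<and> s = t \<and> (u, v) \<in> parcs G"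
    if "u \<in> pverts G" "v \<in> pverts G" "b u \<noteq> b v" for u v s t
    using that G.arcs_symmetric by (auto simp: R_def)
  have product: "((u, s), (v, t)) \<in> parcs (G \<box> path_graph k) \<longleftrightarrow> u \<in> pverts G \<and> v \<in> pverts G \<and>
      s \<le> K \<and> t \<le> K \<and> (s = t \<and> (u, v) \<in> parcs G \<or> u = v \<and> (t = Suc s \<or> s = Suc t))" for u s v t
    by (auto simp: cartesian_product_def path_graph_def k less_Suc_eq_le)
  have orient: "orientation D (G \<box> path_graph k)"
    unfolding orientation_def
  proof (intro conjI)
    show "pverts D = pverts (G \<box> path_graph k)"
      by (simp add: D_def cartesian_product_def path_graph_def)
    show "parcs D \<union> (parcs D)\<inverse> = parcs (G \<box> path_graph k)"
    proof -
      have "((u, s), (v, t)) \<in> R \<or> ((v, t), (u, s)) \<in> R \<longleftrightarrow>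
          ((u, s), (v, t)) \<in> parcs (G \<box> path_graph k)" for u s v t
      proof (cases "u \<in> pverts G \<and> v \<in> pverts G")
        case True
        then show ?thesis
          using same[of u v s t] different[of u v s t] unfolding product by metis
      next
        case False
        then show ?thesis using R_sub unfolding product by blast
      qed
      then show ?thesis by (auto simp: D_def set_eq_iff)
    qed
    have "((v, t), (u, s)) \<notin> R" if uv: "((u, s), (v, t)) \<in> R" for u s v t
    proof (cases "b u = b v")
      case True
      have "b u \<in> {1..m}" using uv b R_sub by blast
      then show ?thesis
        using True uv ladder_asym[OF n[of "b u"]] by (auto simp: R_def)
    next
      case False
      then show ?thesis using uv by (auto simp: R_def)
    qed
    then show "parcs D \<inter> (parcs D)\<inverse> = {}" by (auto simp: D_def)
  qed

  have deg: "in_degree (with_proj D) p \<le> 2 + \<rho>" if p: "p \<in> pverts D" for p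
  proof -
    obtain v t where vt: "p = (v, t)" "v \<in> pverts G" using p by (auto simp: D_def)
    define i where "i = b v"
    have i: "i \<in> {1..m}" "v \<in> S i" using b[OF vt(2)] by (auto simp: i_def)
    \<comment> \<open>Arcs into \<open>(v, t)\<close> are sorted by origin: those from the block of
      \<open>v\<close> inject into the ladder and number at most 2, while the others come from
      neighbours in earlier blocks, collected in \<open>N\<close>.\<close>
    define C where "C = {a \<in> R. snd a = (v, t) \<and> b (fst (fst a)) = i}"
    define N where "N = {w \<in> (\<Union>j\<in>{1..i - 1}. S j). v \<rightarrow>\<^bsub>G\<^esub> w}"
    let ?g = "\<lambda>(u, s). (f i u, s :: nat)"
    have "card C \<le> card {a \<in> ladder (n i) K. snd a = (f i v, t)}"
    proof (rule card_inj_on_le)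
      have "u \<in> S i" if "u \<in> pverts G" "b u = i" for u
        using b[OF that(1)] that(2) by simp
      then have C_sub: "C \<subseteq> (S i \<times> UNIV) \<times> (S i \<times> UNIV)"
        unfolding C_def R_def i_def by auto
      have inj_g: "inj_on ?g (S i \<times> UNIV)"
        using bij[OF i(1)] by (auto simp: inj_on_def bij_betw_def)
      show "inj_on (map_prod ?g ?g) C"
        by (rule inj_on_subset[OF map_prod_inj_on[OF inj_g inj_g] C_sub])
      show "map_prod ?g ?g ` C \<subseteq> {a \<in> ladder (n i) K. snd a = (f i v, t)}"
        by (auto simp: C_def R_def i_def)
    qed simp
    then have "card C \<le> 2" using in_degree_ladder[OF n[OF i(1)]] by (rule order_trans)
    have fin_N: "finite N"
      by (rule finite_subset[of _ "pverts G"]) (auto simp: N_def G.pair_finite_verts dest: G.in_arcsD2)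
    have "card N \<le> \<rho>"
    \<comment> \<open>The degree hypothesis starts at block 2; for block 1 the range
      \<open>{1..i - 1}\<close> is empty.\<close>
    proof (cases "i = 1")
      case True
      then show ?thesis by (simp add: N_def)
    next
      case False
      then show ?thesis unfolding N_def using i by (intro assms(6)) auto
    qed
    have "{a \<in> R. snd a = (v, t)} \<subseteq> C \<union> (\<lambda>w. ((w, t), (v, t))) ` N"
    proof
      fix a assume "a \<in> {a \<in> R. snd a = (v, t)}"
      then obtain u s where a: "a = ((u, s), (v, t))" "((u, s), (v, t)) \<in> R"
        by (cases a) auto
      show "a \<in> C \<union> (\<lambda>w. ((w, t), (v, t))) ` N"
      proof (cases "b u = i")
        case True
        then show ?thesis using a by (simp add: C_def)
      next
        case False
        then have *: "b u < i" "s = t" "(u, v) \<in> parcs G" "u \<in> pverts G"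
          using a(2) by (auto simp: R_def i_def)
        then have "u \<in> N"
          using b[of u] G.arcs_symmetric[of u v] by (auto simp: N_def intro!: bexI[of _ "b u"])
        then show ?thesis using a(1) *(2) by simp
      qed
    qed
    then have "card {a \<in> R. snd a = (v, t)} \<le> card (C \<union> (\<lambda>w. ((w, t), (v, t))) ` N)"
      using fin_R fin_N by (intro card_mono) (auto simp: C_def)
    also have "\<dots> \<le> card C + card ((\<lambda>w. ((w, t), (v, t))) ` N)" by (rule card_Un_le)
    also have "\<dots> \<le> 2 + \<rho>"
      using \<open>card C \<le> 2\<close> \<open>card N \<le> \<rho>\<close> card_image_le[OF fin_N, of "\<lambda>w. ((w, t), (v, t))"] by linarith
    finally show ?thesis
      by (simp add: in_degree_def in_arcs_def D_def vt)
  qed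

  \<comment> \<open>Blocks are added one at a time; \<open>W i\<close> is the part over the first
    \<open>i\<close> blocks, and \<open>W 0\<close> is empty because indices start at 1.\<close>
  define W where "W i = {v \<in> pverts G. b v \<le> i} \<times> {..K}" for i
  have "odd (card (flows (R \<inter> W i \<times> W i) (\<lambda>_. 0)))" if "i \<le> m" for i
    using that
  proof (induction i)
    case 0
    have "W 0 = {}" using b by (force simp: W_def)
    then have "flows (R \<inter> W 0 \<times> W 0) (\<lambda>_. 0) = {{}}" by (auto simp: flows_def)
    then show ?case by simp
  next
    case (Suc i)
    let ?j = "Suc i"
    let ?T = "S ?j \<times> {..K}"
    let ?g = "\<lambda>(u, s). (f ?j u, s :: nat)"
    have j: "?j \<in> {1..m}" using Suc.prems by simp
    have b_T: "b v = ?j \<longleftrightarrow> v \<in> S ?j" if "v \<in> pverts G" for v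
      using b[OF that] b_eq[OF j] by auto
    have W_Suc: "W ?j = W i \<union> ?T"
      using S_V[OF j] b_T by (auto simp: W_def le_Suc_eq)
    \<comment> \<open>All arcs between \<open>W i\<close> and the new block leave
      \<open>W i\<close>, so they form the cut discarded by
      \<open>card_circulations_Un_cut\<close>.\<close>
    have no_return: "R \<inter> ?T \<times> W i = {}"
      using b_eq[OF j] by (auto simp: R_def W_def)
    have "R \<inter> W ?j \<times> W ?j = (R \<inter> W i \<times> W i) \<union> (R \<inter> ?T \<times> ?T) \<union> (R \<inter> W i \<times> ?T)"
      unfolding W_Suc using no_return by blast
    also have "card (flows \<dots> (\<lambda>_. 0)) =
        card (flows (R \<inter> W i \<times> W i) (\<lambda>_. 0)) * card (flows (R \<inter> ?T \<times> ?T) (\<lambda>_. 0))"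
    proof (rule card_circulations_Un_cut)
      show "finite (W i)" by (simp add: W_def G.pair_finite_verts)
      show "W i \<inter> ?T = {}" using b_eq[OF j] by (auto simp: W_def)
    qed (use fin_R in auto)
    also have "card (flows (R \<inter> ?T \<times> ?T) (\<lambda>_. 0)) =
        card (flows (map_prod ?g ?g ` (R \<inter> ?T \<times> ?T)) (\<lambda>_. 0))"
      using bij[OF j]
      by (intro card_circulations_image[symmetric, of _ ?T]) (auto simp: inj_on_def bij_betw_def)
    also have "map_prod ?g ?g ` (R \<inter> ?T \<times> ?T) = ladder (n ?j) K"
    proof
      show "map_prod ?g ?g ` (R \<inter> ?T \<times> ?T) \<subseteq> ladder (n ?j) K"
        using b_eq[OF j] by (auto simp: R_def)
      show "ladder (n ?j) K \<subseteq> map_prod ?g ?g ` (R \<inter> ?T \<times> ?T)"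
      proof clarify
        fix x s y t assume a: "((x, s), (y, t)) \<in> ladder (n ?j) K"
        then have "x < n ?j" "y < n ?j" "s \<le> K" "t \<le> K"
          using ladder_subset[OF n[OF j], of K] by auto
        moreover from this obtain u v where "u \<in> S ?j" "v \<in> S ?j" "x = f ?j u" "y = f ?j v"
          using bij[OF j] unfolding bij_betw_def by (metis imageE lessThan_iff)
        ultimately have "((u, s), (v, t)) \<in> R \<inter> ?T \<times> ?T"
          using a b_eq[OF j] S_V[OF j] by (auto simp: R_def)
        then show "((x, s), (y, t)) \<in> map_prod ?g ?g ` (R \<inter> ?T \<times> ?T)"
          using \<open>x = f ?j u\<close> \<open>y = f ?j v\<close> by (intro rev_image_eqI) auto
      qed
    qed
    finally show ?case
      using Suc odd_card_circulations_ladder[OF n[OF j], of K] by simp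
  qed
  moreover have "R \<inter> W m \<times> W m = parcs D"
    using R_sub b by (auto simp: W_def D_def)
  ultimately have "odd (card (flows (parcs D) (\<lambda>_. 0)))" by (metis order_refl)
  moreover have "pverts D \<noteq> {}"
  proof -
    have "S 1 \<noteq> {}" using \<open>m \<ge> 1\<close> assms(3) by (auto simp: partition_on_def)
    then show ?thesis using V \<open>m \<ge> 1\<close> by (auto simp: D_def k)
  qed
  ultimately have "alon_tarsi_number (G \<box> path_graph k) \<le> Suc (2 + \<rho>)"
    using orient D deg by (intro alon_tarsi_number_le) auto
  then show ?thesis by simp
qed

end
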